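(* Let $G$ be a self-contained graph, $H \in \mathrm{Rem}(G)$, and suppose $\mathrm{Tor}_G(H) \neq \emptyset$. Then $\mathrm{Fnd}(G)$ is a self-contained graph which has a removable subgraph $P$ isomorphic to $\mathrm{Tor}_G(H)$.
   Context: All graphs are simple; $\emptyset$ denotes the null graph (no vertices). A self-contained graph is an infinite graph which is isomorphic to one of its proper induced subgraphs. For an induced subgraph $H$ of $G$, $G \setminus H$ denotes $G[V(G)\setminus V(H)]$. For a self-contained graph $G$, a removable subgraph of $G$ is a proper induced subgraph $H$ of $G$ with $V(H)\neq\emptyset$ such that $G\setminus H \cong G$; $\mathrm{Rem}(G)$ is the set of removable subgraphs. The foundation $\mathrm{Fnd}(G)=\bigcap_{H\in\mathrm{Rem}(G)} G\setminus H$ is the induced subgraph of $G$ on the vertices lying in no removable subgraph of $G$; for $H\in\mathrm{Rem}(G)$ the graph $G\setminus H\cong G$ is self-contained so $\mathrm{Fnd}(G\setminus H)$ is defined likewise. For $H\in\mathrm{Rem}(G)$, a vertex $v$ of $G$ is a twisted vertex for $H$ if there exists $P\in\mathrm{Rem}(G)$ with $v\in V(P)$ and $v\in V(\mathrm{Fnd}(G\setminus H))$; the torsion $\mathrm{Tor}_G(H)$ is the subgraph of $G$ induced by all twisted vertices for $H$. *)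

theory Defs
  imports Main
begin

record 'a sgraph =
  verts :: "'a set"
  edges :: "'a set set"

definition simple_graph :: "'a sgraph \<Rightarrow> bool" where
  "simple_graph G \<longleftrightarrow> (\<forall>e \<in> edges G. e \<subseteq> verts G \<and> card e = 2)"

definition null_graph :: "'a sgraph" where
  "null_graph = \<lparr>verts = {}, edges = {}\<rparr>"

definition induced :: "'a sgraph \<Rightarrow> 'a set \<Rightarrow> 'a sgraph" where
  "induced G S = \<lparr>verts = verts G \<inter> S, edges = {e \<in> edges G. e \<subseteq> S}\<rparr>"

definition proper_induced_subgraph :: "'a sgraph \<Rightarrow> 'a sgraph \<Rightarrow> bool" where
  "proper_induced_subgraph H G \<longleftrightarrow> verts H \<subset> verts G \<and> H = induced G (verts H)"

definition graph_minus :: "'a sgraph \<Rightarrow> 'a sgraph \<Rightarrow> 'a sgraph" where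
  "graph_minus G H = induced G (verts G - verts H)"

definition graph_iso :: "'a sgraph \<Rightarrow> 'b sgraph \<Rightarrow> bool" where
  "graph_iso G H \<longleftrightarrow>
    (\<exists>f. bij_betw f (verts G) (verts H) \<and>
         (\<forall>u \<in> verts G. \<forall>v \<in> verts G. {u, v} \<in> edges G \<longleftrightarrow> {f u, f v} \<in> edges H))"

definition self_contained :: "'a sgraph \<Rightarrow> bool" where
  "self_contained G \<longleftrightarrow> simple_graph G \<and> infinite (verts G) \<and>
    (\<exists>K. proper_induced_subgraph K G \<and> graph_iso G K)"

definition Rem :: "'a sgraph \<Rightarrow> 'a sgraph set" where
  "Rem G = {H. proper_induced_subgraph H G \<and> verts H \<noteq> {} \<and> graph_iso (graph_minus G H) G}"

definition Fnd :: "'a sgraph \<Rightarrow> 'a sgraph" where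
  "Fnd G = induced G (\<Inter>H \<in> Rem G. verts (graph_minus G H))"

definition twisted_vertex :: "'a sgraph \<Rightarrow> 'a sgraph \<Rightarrow> 'a \<Rightarrow> bool" where
  "twisted_vertex G H v \<longleftrightarrow> v \<in> verts G \<and>
    (\<exists>P \<in> Rem G. v \<in> verts P \<and> v \<in> verts (Fnd (graph_minus G H)))"

definition Tor :: "'a sgraph \<Rightarrow> 'a sgraph \<Rightarrow> 'a sgraph" where
  "Tor G H = induced G {v. twisted_vertex G H v}"

end

theory Submission
  imports Defs
begin

text \<open>Put \<open>G' = G \<setminus> H\<close> and let \<open>f : G' \<rightarrow> G\<close> be an isomorphism.
  If \<open>Q\<close> is removable in \<open>G'\<close> then \<open>H \<union> Q\<close> is removable in \<open>G\<close>, so \<open>Fnd G \<subseteq> Fnd G'\<close>, and the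
  torsion of \<open>H\<close> is exactly the difference \<open>Fnd G' \<setminus> Fnd G\<close>. As \<open>f\<close> restricts to an isomorphism
  \<open>Fnd G' \<rightarrow> Fnd G\<close>, deleting the torsion from \<open>Fnd G'\<close> leaves an isomorphic copy of it, and
  the image of the torsion under \<open>f\<close> is removable in \<open>Fnd G\<close>.\<close>

text \<open>Exposes the map hidden by \<open>graph_iso\<close>, since one and the same isomorphism
  has to be restricted to foundations and then to the torsion.\<close>

definition is_iso :: "('a \<Rightarrow> 'b) \<Rightarrow> 'a sgraph \<Rightarrow> 'b sgraph \<Rightarrow> bool" where
  "is_iso f G H \<longleftrightarrow> bij_betw f (verts G) (verts H) \<and>
     (\<forall>u \<in> verts G. \<forall>v \<in> verts G. {u, v} \<in> edges G \<longleftrightarrow> {f u, f v} \<in> edges H)"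

text \<open>The vertex sets of the members of \<open>Rem G\<close>. A proper induced subgraph is
  determined by its vertices, and sets are easier to unite and to map than graphs.\<close>

definition rem_set :: "'a sgraph \<Rightarrow> 'a set \<Rightarrow> bool" where
  "rem_set G S \<longleftrightarrow> S \<subset> verts G \<and> S \<noteq> {} \<and> graph_iso (induced G (verts G - S)) G"

section \<open>Isomorphisms and induced subgraphs\<close>

lemma graph_iso_iff_is_iso: "graph_iso G H \<longleftrightarrow> (\<exists>f. is_iso f G H)"
  unfolding graph_iso_def is_iso_def ..

lemma is_iso_inv_into:
  assumes "is_iso f G H"
  shows "is_iso (inv_into (verts G) f) H G"
proof -
  let ?g = "inv_into (verts G) f"
  have f: "bij_betw f (verts G) (verts H)" using assms by (simp add: is_iso_def)
  have g: "bij_betw ?g (verts H) (verts G)" by (rule bij_betw_inv_into[OF f])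
  have "{x, y} \<in> edges H \<longleftrightarrow> {?g x, ?g y} \<in> edges G" if "x \<in> verts H" "y \<in> verts H" for x y
  proof -
    have "?g x \<in> verts G" "?g y \<in> verts G" using g that by (auto dest: bij_betwE)
    moreover have "f (?g x) = x" "f (?g y) = y"
      using f that by (auto simp: bij_betw_inv_into_right)
    ultimately show ?thesis using assms unfolding is_iso_def by metis
  qed
  with g show ?thesis by (simp add: is_iso_def)
qed

lemma graph_iso_sym: "graph_iso G H \<Longrightarrow> graph_iso H G"
  unfolding graph_iso_iff_is_iso by (blast intro: is_iso_inv_into)

lemma is_iso_comp:
  assumes "is_iso f G H" "is_iso g H K"
  shows "is_iso (g \<circ> f) G K"
  using assms bij_betw_trans[of f "verts G" "verts H" g "verts K"]
  unfolding is_iso_def by (auto dest: bij_betwE)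

lemma graph_iso_trans: "graph_iso G H \<Longrightarrow> graph_iso H K \<Longrightarrow> graph_iso G K"
  unfolding graph_iso_iff_is_iso by (blast intro: is_iso_comp)

lemma verts_induced [simp]: "verts (induced G S) = verts G \<inter> S"
  by (simp add: induced_def)

lemma edges_induced [simp]: "edges (induced G S) = {e \<in> edges G. e \<subseteq> S}"
  by (simp add: induced_def)

lemma induced_induced [simp]: "induced (induced G S) T = induced G (S \<inter> T)"
  by (auto simp: induced_def)

lemma simple_graph_induced: "simple_graph G \<Longrightarrow> simple_graph (induced G S)"
  by (auto simp: simple_graph_def)

lemma is_iso_induced:
  assumes "is_iso f G H" "S \<subseteq> verts G"
  shows "is_iso f (induced G S) (induced H (f ` S))"
proof -
  have b: "bij_betw f (verts G) (verts H)" using assms by (simp add: is_iso_def)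
  then have "verts H \<inter> f ` S = f ` S" using assms(2) by (auto simp: bij_betw_def)
  then have "bij_betw f (verts (induced G S)) (verts (induced H (f ` S)))"
    using b assms(2) by (auto simp: Int_absorb1 intro: bij_betw_subset)
  moreover have "{u, v} \<in> edges (induced G S) \<longleftrightarrow> {f u, f v} \<in> edges (induced H (f ` S))"
    if "u \<in> verts (induced G S)" "v \<in> verts (induced G S)" for u v
    using assms that by (auto simp: is_iso_def)
  ultimately show ?thesis by (simp add: is_iso_def)
qed

lemma rem_set_image:
  assumes f: "is_iso f G H" and S: "rem_set G S"
  shows "rem_set H (f ` S)"
proof -
  have b: "inj_on f (verts G)" "f ` verts G = verts H"
    using f by (auto simp: is_iso_def bij_betw_def)
  have SG: "S \<subset> verts G" "S \<noteq> {}" using S by (auto simp: rem_set_def)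
  have im: "f ` (verts G - S) = verts H - f ` S"
    using inj_on_image_set_diff[OF b(1), of "verts G" S] SG b(2) by auto
  have "graph_iso (induced G (verts G - S)) (induced H (verts H - f ` S))"
    using is_iso_induced[OF f, of "verts G - S"] im by (auto simp: graph_iso_iff_is_iso)
  moreover have "graph_iso (induced G (verts G - S)) G" using S by (simp add: rem_set_def)
  moreover have "graph_iso G H" using f by (auto simp: graph_iso_iff_is_iso)
  ultimately have "graph_iso (induced H (verts H - f ` S)) H"
    by (meson graph_iso_sym graph_iso_trans)
  moreover have "f ` S \<subset> verts H" using im SG b by blast
  ultimately show ?thesis using SG by (simp add: rem_set_def)
qed

lemma rem_set_verts: "H \<in> Rem G \<Longrightarrow> rem_set G (verts H)"
  by (auto simp: Rem_def rem_set_def proper_induced_subgraph_def graph_minus_def)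

lemma induced_in_Rem:
  assumes "rem_set G S"
  shows "induced G S \<in> Rem G"
proof -
  have "verts G \<inter> S = S" using assms by (auto simp: rem_set_def)
  then show ?thesis
    using assms by (simp add: Rem_def rem_set_def proper_induced_subgraph_def graph_minus_def)
qed

lemma bex_Rem_iff: "(\<exists>P \<in> Rem G. v \<in> verts P) \<longleftrightarrow> (\<exists>S. rem_set G S \<and> v \<in> S)"
proof
  assume "\<exists>S. rem_set G S \<and> v \<in> S"
  then obtain S where S: "rem_set G S" "v \<in> S" by blast
  then have "v \<in> verts (induced G S)" by (auto simp: rem_set_def)
  then show "\<exists>P \<in> Rem G. v \<in> verts P" using induced_in_Rem[OF S(1)] by blast
qed (blast dest: rem_set_verts)

section \<open>Foundations and their transport along isomorphisms\<close>

lemma verts_Fnd: "verts (Fnd G) = {v \<in> verts G. \<nexists>S. rem_set G S \<and> v \<in> S}"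
proof -
  have "verts (Fnd G) = {v \<in> verts G. \<not> (\<exists>P \<in> Rem G. v \<in> verts P)}"
    by (auto simp: Fnd_def graph_minus_def)
  then show ?thesis by (simp add: bex_Rem_iff)
qed

text \<open>Simplicity keeps every edge inside \<open>verts G\<close>. This matters when
  \<open>Rem G\<close> is empty: the intersection defining \<open>Fnd G\<close> is then the whole
  type.\<close>

lemma Fnd_eq_induced: "simple_graph G \<Longrightarrow> Fnd G = induced G (verts (Fnd G))"
  by (auto simp: Fnd_def induced_def simple_graph_def)

text \<open>A removable set of \<open>H\<close> containing \<open>f x\<close> would be pulled back
  by the inverse of \<open>f\<close> to a removable set of \<open>G\<close> containing
  \<open>x\<close>.\<close>

lemma image_verts_Fnd_subset:
  assumes "is_iso f G H"
  shows "f ` verts (Fnd G) \<subseteq> verts (Fnd H)"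
proof
  fix y assume "y \<in> f ` verts (Fnd G)"
  then obtain x where x: "x \<in> verts (Fnd G)" "y = f x" by blast
  let ?g = "inv_into (verts G) f"
  have b: "bij_betw f (verts G) (verts H)" using assms by (simp add: is_iso_def)
  have xG: "x \<in> verts G" using x by (simp add: verts_Fnd)
  have "?g y = x" using b xG x(2) by (simp add: bij_betw_inv_into_left)
  then have "y \<notin> S" if "rem_set H S" for S
    using rem_set_image[OF is_iso_inv_into[OF assms] that] x(1) by (auto simp: verts_Fnd)
  moreover have "y \<in> verts H" using b xG x(2) by (auto dest: bij_betwE)
  ultimately show "y \<in> verts (Fnd H)" by (auto simp: verts_Fnd)
qed

lemma image_verts_Fnd:
  assumes "is_iso f G H"
  shows "f ` verts (Fnd G) = verts (Fnd H)"
proof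
  show "verts (Fnd H) \<subseteq> f ` verts (Fnd G)"
  proof
    fix y assume y: "y \<in> verts (Fnd H)"
    have b: "bij_betw f (verts G) (verts H)" using assms by (simp add: is_iso_def)
    have "f (inv_into (verts G) f y) = y"
      using b y by (simp add: bij_betw_inv_into_right verts_Fnd)
    moreover have "inv_into (verts G) f y \<in> verts (Fnd G)"
      using image_verts_Fnd_subset[OF is_iso_inv_into[OF assms]] y by blast
    ultimately show "y \<in> f ` verts (Fnd G)" by force
  qed
qed (rule image_verts_Fnd_subset[OF assms])

lemma is_iso_Fnd:
  assumes "is_iso f G H" "simple_graph G" "simple_graph H"
  shows "is_iso f (Fnd G) (Fnd H)"
proof -
  have "verts (Fnd G) \<subseteq> verts G" by (auto simp: verts_Fnd)
  from is_iso_induced[OF assms(1) this] show ?thesis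
    using Fnd_eq_induced[OF assms(2)] Fnd_eq_induced[OF assms(3)] image_verts_Fnd[OF assms(1)]
    by simp
qed

section \<open>Successive removals and the torsion\<close>

lemma rem_set_Un:
  assumes S: "rem_set G S" and T: "rem_set (induced G (verts G - S)) T"
  shows "rem_set G (S \<union> T)"
proof -
  have "verts G \<inter> (verts G - S) = verts G - S" by blast
  then have sub: "T \<subset> verts G - S" and
    "graph_iso (induced G ((verts G - S) \<inter> (verts G - S - T))) (induced G (verts G - S))"
    using T by (auto simp: rem_set_def)
  moreover have "(verts G - S) \<inter> (verts G - S - T) = verts G - (S \<union> T)" by blast
  \<comment> \<open>Removing \<open>T\<close> after \<open>S\<close> leaves a copy of
    \<open>G\<close> minus \<open>S\<close>, which is itself a copy of \<open>G\<close>.\<close>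
  ultimately have "graph_iso (induced G (verts G - (S \<union> T))) G"
    using S by (auto simp: rem_set_def intro: graph_iso_trans)
  then show ?thesis using S sub by (auto simp: rem_set_def)
qed

text \<open>A vertex of \<open>Fnd G\<close> avoids the removable \<open>H\<close>. A removable set
  of the remainder containing it would, joined with \<open>H\<close>, be removable in
  \<open>G\<close>.\<close>

lemma verts_Fnd_subset_Fnd_minus:
  assumes "H \<in> Rem G"
  shows "verts (Fnd G) \<subseteq> verts (Fnd (graph_minus G H))"
  using rem_set_Un[OF rem_set_verts[OF assms]] rem_set_verts[OF assms]
  by (fastforce simp: verts_Fnd graph_minus_def)

text \<open>For a vertex of \<open>G\<close>, lying in some removable subgraph is the same as lying
  outside \<open>Fnd G\<close>.\<close>

lemma verts_Tor: "verts (Tor G H) = verts (Fnd (graph_minus G H)) - verts (Fnd G)"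
proof -
  have "twisted_vertex G H v \<longleftrightarrow> v \<in> verts G \<and> (\<exists>S. rem_set G S \<and> v \<in> S) \<and>
      v \<in> verts (Fnd (graph_minus G H))" for v
    using bex_Rem_iff[of G v] unfolding twisted_vertex_def by blast
  moreover have "verts (Fnd (graph_minus G H)) \<subseteq> verts G"
    by (auto simp: verts_Fnd graph_minus_def)
  ultimately show ?thesis by (auto simp: Tor_def verts_Fnd[of G])
qed

lemma Tor_eq_induced: "simple_graph G \<Longrightarrow> Tor G H = induced G (verts (Tor G H))"
  by (auto simp: Tor_def induced_def simple_graph_def)

lemma verts_nonempty_if_not_null:
  assumes "simple_graph G" "G \<noteq> null_graph"
  shows "verts G \<noteq> {}"
proof
  assume "verts G = {}"
  moreover from this have "edges G = {}" using assms(1) by (fastforce simp: simple_graph_def)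
  ultimately show False using assms(2) by (simp add: null_graph_def)
qed

text \<open>The complement of \<open>S\<close> is the required proper copy of \<open>G\<close>; a
  finite vertex set has no bijection with a proper subset, so \<open>G\<close> is infinite.\<close>

lemma self_contained_if_rem_set:
  assumes "simple_graph G" "rem_set G S"
  shows "self_contained G"
proof -
  let ?K = "induced G (verts G - S)"
  have iso: "graph_iso ?K G" and sub: "verts ?K \<subset> verts G"
    using assms(2) by (auto simp: rem_set_def)
  have "infinite (verts G)"
  proof
    assume "finite (verts G)"
    moreover obtain f where "bij_betw f (verts ?K) (verts G)"
      using iso unfolding graph_iso_def by blast
    ultimately show False using psubset_card_mono[OF _ sub] bij_betw_same_card by fastforce
  qed
  moreover have "proper_induced_subgraph ?K G"
    unfolding proper_induced_subgraph_def using sub by (simp add: Int_absorb1)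
  ultimately show ?thesis
    using assms(1) graph_iso_sym[OF iso] by (auto simp: self_contained_def)
qed

theorem theorem3p6:
  fixes G H :: "'a sgraph"
  assumes "self_contained G"
    and "H \<in> Rem G"
    and "Tor G H \<noteq> null_graph"
  shows "self_contained (Fnd G) \<and> (\<exists>P \<in> Rem (Fnd G). graph_iso P (Tor G H))"
proof -
  define G' where "G' = graph_minus G H"
  define T where "T = verts (Tor G H)"
  have sG: "simple_graph G" using assms(1) by (simp add: self_contained_def)
  then have sG': "simple_graph G'" by (simp add: G'_def graph_minus_def simple_graph_induced)
  have sF: "simple_graph (Fnd G)" using sG by (simp add: Fnd_def simple_graph_induced)
  obtain f where "is_iso f G' G"
    using assms(2) by (auto simp: Rem_def graph_iso_iff_is_iso G'_def)
  then have f: "is_iso f (Fnd G') (Fnd G)" using sG' sG by (rule is_iso_Fnd)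
  have T: "T = verts (Fnd G') - verts (Fnd G)" by (simp add: T_def G'_def verts_Tor)
  have sub: "verts (Fnd G) \<subseteq> verts (Fnd G')"
    using verts_Fnd_subset_Fnd_minus[OF assms(2)] by (simp add: G'_def)
  have "T \<noteq> {}" unfolding T_def
    using assms(3) sG by (intro verts_nonempty_if_not_null) (auto simp: Tor_def simple_graph_induced)
  have Fsub: "verts (Fnd G') \<subseteq> verts G'" by (auto simp: verts_Fnd)
  \<comment> \<open>\<open>Fnd G'\<close> is obtained from \<open>G\<close> by two nested
    restrictions, both of which keep \<open>S\<close>.\<close>
  have ind: "induced (Fnd G') S = induced G S" if "S \<subseteq> verts (Fnd G')" for S
  proof -
    have "verts G' = verts G - verts H" by (auto simp: G'_def graph_minus_def)
    then have "(verts G - verts H) \<inter> (verts (Fnd G') \<inter> S) = S" using that Fsub by blast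
    moreover have "Fnd G' = induced (induced G (verts G - verts H)) (verts (Fnd G'))"
      using Fnd_eq_induced[OF sG'] by (simp add: G'_def graph_minus_def)
    ultimately show ?thesis
      by (metis induced_induced Int_assoc)
  qed
  have "induced (Fnd G') (verts (Fnd G') - T) = Fnd G"
  proof -
    have "verts (Fnd G') - T = verts (Fnd G)" using T sub by blast
    then show ?thesis using ind[OF sub] Fnd_eq_induced[OF sG] by simp
  qed
  \<comment> \<open>Properness requires \<open>Fnd G\<close> to be nonempty: it is the image under
    \<open>f\<close> of \<open>Fnd G'\<close>, which contains the nonempty \<open>T\<close>.\<close>
  moreover have "T \<subset> verts (Fnd G')"
  proof -
    have "f ` verts (Fnd G') = verts (Fnd G)" using f by (simp add: is_iso_def bij_betw_def)
    then have "verts (Fnd G) \<noteq> {}" using \<open>T \<noteq> {}\<close> T by blast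
    then show ?thesis using T sub by blast
  qed
  moreover have "graph_iso (Fnd G) (Fnd G')"
    using graph_iso_sym f graph_iso_iff_is_iso by blast
  ultimately have "rem_set (Fnd G') T" using \<open>T \<noteq> {}\<close> by (simp add: rem_set_def)
  then have r: "rem_set (Fnd G) (f ` T)" by (rule rem_set_image[OF f])
  have TF: "T \<subseteq> verts (Fnd G')" using T by blast
  have "induced (Fnd G') T = Tor G H"
    using ind[OF TF] Tor_eq_induced[OF sG] by (simp add: T_def)
  then have "graph_iso (induced (Fnd G) (f ` T)) (Tor G H)"
    using is_iso_induced[OF f TF] graph_iso_sym graph_iso_iff_is_iso by metis
  then show ?thesis
    using self_contained_if_rem_set[OF sF r] induced_in_Rem[OF r] by blast
qed

end
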